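(* Let $N>2$, $\alpha_0>0$, $\alpha_\mu<0$ for $0<\mu<N$, let $\tau\in\{1,\dots,N-1\}$ be an index with $|\alpha_\tau|=\min_{0<\mu<N}|\alpha_\mu|$, put $\alpha_{(c)}:=\big(\sum_{\mu=1}^{N-1}|\alpha_\mu|^{-1}\big)^{-1}$, and for $0<\alpha_0<|\alpha_\tau|$ define $f:[0,\pi]\to\mathbb{R}$ by $$f(\Psi)=\sum_{\mu=1}^{N-1}\arcsin\Big(\frac{\alpha_0}{|\alpha_\mu|}\sin\Psi\Big).$$ (i) For $\alpha_{(c)}<\alpha_0<|\alpha_\tau|$ the equation $\Psi=f(\Psi)$ has a unique non-zero solution, denoted $\Psi(\alpha_0)$. (ii) With $\alpha_1,\dots,\alpha_{N-1}$ fixed, the function $\alpha_0\mapsto\Psi(\alpha_0)$ is analytic for $\alpha_{(c)}<\alpha_0<|\alpha_\tau|$. (iii) Keep $\alpha_0<|\alpha_\tau|$ and all couplings $\alpha_\mu$ with $\mu\ne N-\tau$ fixed and consider the non-zero solution $\Psi$ of $\Psi=f(\Psi)$ as a function of the variable $|\alpha_{N-\tau}|$. Let $S^*:=\sum_{\mu=1,\,\mu\ne N-\tau}^{N-1}\frac{1}{|\alpha_\mu|}$. Then $|\alpha_{N-\tau}|\mapsto\Psi(|\alpha_{N-\tau}|)$ is analytic for $$|\alpha_\tau|<|\alpha_{N-\tau}|<\begin{cases}\big(\frac{1}{\alpha_0}-S^*\big)^{-1} & \text{if } \frac1{\alpha_0}>S^*,\\ \infty & \text{otherwise.}\end{cases}$$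 If $N-\tau=\tau$, then the lower bound for $|\alpha_{N-\tau}|$ in this condition has to be replaced by $\alpha_0$.
   Context: All numbers are real; "analytic" means real analytic. In the case $N-\tau=\tau$ of part (iii), the varied coupling is $\alpha_\tau$ itself; the initial assumption $\alpha_0<|\alpha_\tau|\le|\alpha_\mu|$ guarantees $\alpha_0<|\alpha_\mu|$ for all the fixed couplings $\alpha_\mu$, $\mu\neq\tau$, and the variable $|\alpha_\tau|$ ranges over values larger than $\alpha_0$. *)

theory Defs
  imports "HOL-Analysis.Analysis"
begin

text \<open>
  The couplings \<open>\<alpha>\<^sub>1, \<dots>, \<alpha>\<^sub>N\<^sub>-\<^sub>1\<close> are the values of \<open>\<alpha>\<close> on \<open>{1..N-1}\<close>. The coupling \<open>\<alpha>\<^sub>0\<close> is a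
  separate parameter \<open>a\<close>, so that it can be varied; \<open>\<alpha> 0\<close> is never used.
\<close>

definition critical_coupling :: "nat \<Rightarrow> (nat \<Rightarrow> real) \<Rightarrow> real" where
  "critical_coupling N \<alpha> = inverse (\<Sum>\<mu>\<in>{1..N-1}. inverse \<bar>\<alpha> \<mu>\<bar>)"

definition phase_sum :: "nat \<Rightarrow> (nat \<Rightarrow> real) \<Rightarrow> real \<Rightarrow> real \<Rightarrow> real" where
  "phase_sum N \<alpha> a \<Psi> = (\<Sum>\<mu>\<in>{1..N-1}. arcsin (a / \<bar>\<alpha> \<mu>\<bar> * sin \<Psi>))"

definition nonzero_solution :: "nat \<Rightarrow> (nat \<Rightarrow> real) \<Rightarrow> real \<Rightarrow> real \<Rightarrow> bool" where
  "nonzero_solution N \<alpha> a \<Psi> \<longleftrightarrow> \<Psi> \<in> {0..pi} \<and> \<Psi> \<noteq> 0 \<and> \<Psi> = phase_sum N \<alpha> a \<Psi>"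

text \<open>Meaningful only where the non-zero solution exists and is unique.\<close>

definition the_nonzero_solution :: "nat \<Rightarrow> (nat \<Rightarrow> real) \<Rightarrow> real \<Rightarrow> real" where
  "the_nonzero_solution N \<alpha> a = (THE \<Psi>. nonzero_solution N \<alpha> a \<Psi>)"

text \<open>
  The constant \<open>analytic_on\<close> of the library is restricted to complex functions. Real analyticity
  means being given near each point by a convergent power series; \<open>has_fps_expansion\<close> includes the
  positive radius of convergence.
\<close>

definition real_analytic_on :: "(real \<Rightarrow> real) \<Rightarrow> real set \<Rightarrow> bool" where
  "real_analytic_on g S \<longleftrightarrow> (\<forall>x\<in>S. \<exists>F. (\<lambda>h. g (x + h)) has_fps_expansion F)"

definition reciprocal_sum_except :: "nat \<Rightarrow> nat \<Rightarrow> (nat \<Rightarrow> real) \<Rightarrow> real" where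
  "reciprocal_sum_except N \<nu> \<alpha> = (\<Sum>\<mu>\<in>{1..N-1} - {\<nu>}. 1 / \<bar>\<alpha> \<mu>\<bar>)"

text \<open>The admissible range of \<open>\<bar>\<alpha>\<^sub>N\<^sub>-\<^sub>\<tau>\<bar>\<close>; it does not depend on the value of \<open>\<alpha> (N - \<tau>)\<close>.\<close>

definition coupling_range :: "nat \<Rightarrow> nat \<Rightarrow> (nat \<Rightarrow> real) \<Rightarrow> real \<Rightarrow> real set" where
  "coupling_range N \<tau> \<alpha> a =
    {x. (if N - \<tau> = \<tau> then a else \<bar>\<alpha> \<tau>\<bar>) < x \<and>
        ereal x < (let S = reciprocal_sum_except N (N - \<tau>) \<alpha>
                   in if 1 / a > S then ereal (inverse (1 / a - S)) else \<infinity>)}"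

end

theory Submission
  imports Defs "HOL-Complex_Analysis.Complex_Analysis"
begin

text \<open>
  On \<open>[0, \<pi>]\<close> the function \<open>f\<close> is strictly concave with \<open>f 0 = f \<pi> = 0\<close>, and
  \<open>f' 0 = \<alpha>\<^sub>0 \<Sum> 1 / \<bar>\<alpha>\<^sub>\<mu>\<bar> > 1\<close>; hence there is exactly one non-zero fixed point \<open>\<Psi>\<close>, and
  \<open>f' \<Psi> < 1\<close> there.

  The implicit function theorem is avoided, because in both families the varied parameter is an
  explicit analytic function of one auxiliary variable, whose local inverse is analytic:
  \<^item> with \<open>s = \<alpha>\<^sub>0 sin \<Psi>\<close> and \<open>h s = \<Sum> arcsin (s / \<bar>\<alpha>\<^sub>\<mu>\<bar>)\<close>, the equation reads \<open>\<Psi> = h s\<close>,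
    \<open>\<alpha>\<^sub>0 = s / sin (h s)\<close>;
  \<^item> with \<open>r \<Psi>\<close> the sum of the terms of \<open>f \<Psi>\<close> for the fixed couplings, the varied coupling is
    \<open>\<alpha>\<^sub>0 sin \<Psi> / sin (\<Psi> - r \<Psi>)\<close>.

  In both cases the derivative does not vanish precisely because \<open>f' \<Psi> < 1\<close>.
\<close>

subsection \<open>Real analytic functions\<close>

text \<open>
  Real analyticity at a point is handled through a local holomorphic extension, so that quotients,
  compositions and local inverses are inherited from complex analysis.
\<close>

definition real_analytic_at :: "(real \<Rightarrow> real) \<Rightarrow> real \<Rightarrow> bool" where
  "real_analytic_at g x \<longleftrightarrow>
    (\<exists>G. G analytic_on {of_real x} \<and> (\<forall>\<^sub>F t in nhds x. G (of_real t) = complex_of_real (g t)))"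

lemma real_analytic_atE:
  assumes "real_analytic_at g x"
  obtains G where "G analytic_on {of_real x}"
    "\<forall>\<^sub>F t in nhds x. G (of_real t) = complex_of_real (g t)"
  using assms unfolding real_analytic_at_def by blast

lemma real_analytic_at_cong:
  assumes "real_analytic_at g x" "\<forall>\<^sub>F t in nhds x. h t = g t"
  shows "real_analytic_at h x"
proof -
  obtain G where G: "G analytic_on {of_real x}"
    "\<forall>\<^sub>F t in nhds x. G (of_real t) = complex_of_real (g t)"
    using assms(1) by (rule real_analytic_atE)
  have "\<forall>\<^sub>F t in nhds x. G (of_real t) = complex_of_real (h t)"
    using G(2) assms(2) by eventually_elim simp
  with G(1) show ?thesis
    unfolding real_analytic_at_def by blast
qed

lemma real_analytic_at_const: "real_analytic_at (\<lambda>t. c) x"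
  unfolding real_analytic_at_def by (intro exI[of _ "\<lambda>z. of_real c"]) auto

lemma real_analytic_at_ident: "real_analytic_at (\<lambda>t. t) x"
  unfolding real_analytic_at_def by (intro exI[of _ "\<lambda>z. z"]) auto

lemma real_analytic_at_add:
  assumes "real_analytic_at g x" "real_analytic_at h x"
  shows "real_analytic_at (\<lambda>t. g t + h t) x"
proof -
  obtain G where G: "G analytic_on {of_real x}"
    "\<forall>\<^sub>F t in nhds x. G (of_real t) = complex_of_real (g t)"
    using assms(1) by (rule real_analytic_atE)
  obtain H where H: "H analytic_on {of_real x}"
    "\<forall>\<^sub>F t in nhds x. H (of_real t) = complex_of_real (h t)"
    using assms(2) by (rule real_analytic_atE)
  have "\<forall>\<^sub>F t in nhds x. G (of_real t) + H (of_real t) = complex_of_real (g t + h t)"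
    using G(2) H(2) by eventually_elim simp
  then show ?thesis
    unfolding real_analytic_at_def using analytic_on_add[OF G(1) H(1)] by blast
qed

lemma real_analytic_at_mult:
  assumes "real_analytic_at g x" "real_analytic_at h x"
  shows "real_analytic_at (\<lambda>t. g t * h t) x"
proof -
  obtain G where G: "G analytic_on {of_real x}"
    "\<forall>\<^sub>F t in nhds x. G (of_real t) = complex_of_real (g t)"
    using assms(1) by (rule real_analytic_atE)
  obtain H where H: "H analytic_on {of_real x}"
    "\<forall>\<^sub>F t in nhds x. H (of_real t) = complex_of_real (h t)"
    using assms(2) by (rule real_analytic_atE)
  have "\<forall>\<^sub>F t in nhds x. G (of_real t) * H (of_real t) = complex_of_real (g t * h t)"
    using G(2) H(2) by eventually_elim simp
  then show ?thesis
    unfolding real_analytic_at_def using analytic_on_mult[OF G(1) H(1)] by blast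
qed

lemma real_analytic_at_diff:
  assumes "real_analytic_at g x" "real_analytic_at h x"
  shows "real_analytic_at (\<lambda>t. g t - h t) x"
  using real_analytic_at_add[OF assms(1) real_analytic_at_mult[OF real_analytic_at_const[of "-1"] assms(2)]]
  by simp

lemma real_analytic_at_sum:
  assumes "\<And>i. i \<in> I \<Longrightarrow> real_analytic_at (g i) x"
  shows "real_analytic_at (\<lambda>t. \<Sum>i\<in>I. g i t) x"
  using assms
  by (induction I rule: infinite_finite_induct)
    (simp_all add: real_analytic_at_const real_analytic_at_add)

lemma real_analytic_at_imp_isCont:
  assumes "real_analytic_at g x"
  shows "isCont g x"
proof -
  obtain G where G: "G analytic_on {of_real x}"
    "\<forall>\<^sub>F t in nhds x. G (of_real t) = complex_of_real (g t)"
    using assms by (rule real_analytic_atE)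
  have "isCont G (of_real x)"
    using G(1) by (rule analytic_at_imp_isCont)
  then have "isCont (\<lambda>t. G (of_real t)) x"
    by (intro isCont_o2[where f = of_real and g = G]) auto
  then have "isCont (\<lambda>t. Re (G (of_real t))) x"
    by (rule isCont_Re)
  moreover have "\<forall>\<^sub>F t in nhds x. g t = Re (G (of_real t))"
    using G(2) by eventually_elim simp
  ultimately show ?thesis
    using isCont_cong by fast
qed

text \<open>Continuity over the full filter \<open>nhds x\<close>, centre included, so that
  identities valid near \<open>g x\<close> can be pulled back along \<open>g\<close>.\<close>

lemma real_analytic_at_imp_tendsto:
  assumes "real_analytic_at g x"
  shows "(g \<longlongrightarrow> g x) (nhds x)"
  using real_analytic_at_imp_isCont[OF assms]
  by (simp add: continuous_at tendsto_at_iff_tendsto_nhds)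

lemma real_analytic_at_compose:
  assumes "real_analytic_at g x" "real_analytic_at h (g x)"
  shows "real_analytic_at (\<lambda>t. h (g t)) x"
proof -
  obtain G where G: "G analytic_on {of_real x}"
    "\<forall>\<^sub>F t in nhds x. G (of_real t) = complex_of_real (g t)"
    using assms(1) by (rule real_analytic_atE)
  obtain H where H: "H analytic_on {of_real (g x)}"
    "\<forall>\<^sub>F t in nhds (g x). H (of_real t) = complex_of_real (h t)"
    using assms(2) by (rule real_analytic_atE)
  from eventually_compose_filterlim[OF H(2) real_analytic_at_imp_tendsto[OF assms(1)]]
  have Hg: "\<forall>\<^sub>F t in nhds x. H (of_real (g t)) = complex_of_real (h (g t))" .
  have "G (of_real x) = of_real (g x)"
    using eventually_nhds_x_imp_x[OF G(2)] .
  then have "H \<circ> G analytic_on {of_real x}"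
    by (intro analytic_on_compose_gen[OF G(1) H(1)]) auto
  moreover have "\<forall>\<^sub>F t in nhds x. (H \<circ> G) (of_real t) = complex_of_real (h (g t))"
    using G(2) Hg by eventually_elim simp
  ultimately show ?thesis
    unfolding real_analytic_at_def by blast
qed

lemma real_analytic_at_inverse:
  assumes "x \<noteq> 0"
  shows "real_analytic_at inverse x"
  unfolding real_analytic_at_def using assms
  by (intro exI[of _ inverse]) (auto intro!: analytic_intros)

lemma real_analytic_at_divide:
  assumes "real_analytic_at g x" "real_analytic_at h x" "h x \<noteq> 0"
  shows "real_analytic_at (\<lambda>t. g t / h t) x"
  using real_analytic_at_mult[OF assms(1)
      real_analytic_at_compose[OF assms(2) real_analytic_at_inverse[OF assms(3)]]]
  by (simp add: divide_inverse)

lemma real_analytic_at_sin: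
  assumes "real_analytic_at g x"
  shows "real_analytic_at (\<lambda>t. sin (g t)) x"
proof (rule real_analytic_at_compose[OF assms])
  show "real_analytic_at sin (g x)"
    unfolding real_analytic_at_def
    by (intro exI[of _ sin]) (auto intro!: analytic_intros simp: sin_of_real)
qed

lemma real_analytic_at_arcsin:
  assumes "real_analytic_at g x" "\<bar>g x\<bar> < 1"
  shows "real_analytic_at (\<lambda>t. arcsin (g t)) x"
proof (rule real_analytic_at_compose[OF assms(1)])
  show "real_analytic_at arcsin (g x)"
    unfolding real_analytic_at_def
  proof (intro exI conjI)
    \<comment> \<open>The branch cuts of \<open>Arcsin\<close> lie on the real axis outside (-1, 1).
      This radius keeps the disc inside the strip of real parts between -1 and 1.\<close>
    have "Arcsin holomorphic_on ball (of_real (g x)) (1 - \<bar>g x\<bar>)"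
    proof (rule holomorphic_on_Arcsin)
      fix z :: complex assume "z \<in> ball (of_real (g x)) (1 - \<bar>g x\<bar>)"
      then have "\<bar>Re (z - of_real (g x))\<bar> < 1 - \<bar>g x\<bar>"
        using abs_Re_le_cmod[of "z - of_real (g x)"] by (simp add: dist_norm norm_minus_commute)
      then show "\<bar>Re z\<bar> < 1"
        by simp
    qed
    then show "Arcsin analytic_on {of_real (g x)}"
      unfolding analytic_at_ball using assms(2) by (meson diff_gt_0_iff_gt)
    have "\<forall>\<^sub>F t in nhds (g x). \<bar>t\<bar> < 1"
      using assms(2) by (intro order_tendstoD(2)[of abs "\<bar>g x\<bar>"] tendsto_intros filterlim_ident)
    then show "\<forall>\<^sub>F t in nhds (g x). Arcsin (of_real t) = complex_of_real (arcsin t)"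
      by eventually_elim (simp add: of_real_arcsin)
  qed
qed

section \<open>Power series and local inverses\<close>

text \<open>The complex Taylor series of the extension, restricted to real increments, sums to real
  values. Its termwise real part is therefore a real power series with the same sum, and no proof
  that the coefficients are real is required.\<close>

lemma real_analytic_at_imp_has_fps_expansion:
  assumes "real_analytic_at g x"
  shows "\<exists>F. (\<lambda>h. g (x + h)) has_fps_expansion F"
proof -
  obtain G where G: "G analytic_on {of_real x}"
    "\<forall>\<^sub>F t in nhds x. G (of_real t) = complex_of_real (g t)"
    using assms by (rule real_analytic_atE)
  obtain F where F: "(\<lambda>h. G (of_real x + h)) has_fps_expansion F"
    using analytic_at_imp_has_fps_expansion[OF G(1)] by blast
  have "\<forall>\<^sub>F z in nhds 0. norm (z :: complex) < fps_conv_radius F"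
    using F eventually_nhds_in_open[of "eball 0 (fps_conv_radius F)" "0 :: complex"]
    by (simp add: has_fps_expansion_def zero_ereal_def)
  moreover have "\<forall>\<^sub>F z in nhds 0. eval_fps F z = G (of_real x + z)"
    using F by (simp add: has_fps_expansion_def)
  ultimately have "\<forall>\<^sub>F z in nhds 0. (\<lambda>n. fps_nth F n * z ^ n) sums G (of_real x + z)"
    by eventually_elim (metis sums_eval_fps)
  moreover have "filterlim complex_of_real (nhds 0) (nhds 0)"
    using tendsto_of_real[OF filterlim_ident, of 0] by simp
  ultimately have sums: "\<forall>\<^sub>F h in nhds 0.
      (\<lambda>n. fps_nth F n * of_real h ^ n) sums G (of_real x + complex_of_real h)"
    by (rule eventually_compose_filterlim)
  have "\<forall>\<^sub>F h in nhds 0. G (of_real (x + h)) = complex_of_real (g (x + h))"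
    using G(2) by (rule eventually_compose_filterlim) (auto intro!: tendsto_eq_intros filterlim_ident)
  with sums have "\<forall>\<^sub>F h in nhds 0. (\<lambda>n. Re (fps_nth F n) * h ^ n) sums g (x + h)"
  proof eventually_elim
    case (elim h)
    then show ?case
      using sums_Re[OF elim(1)] by (simp flip: of_real_power)
  qed
  then have "(\<lambda>h. g (x + h)) has_fps_expansion Abs_fps (\<lambda>n. Re (fps_nth F n))"
    by (intro has_fps_expansionI) simp
  then show ?thesis ..
qed

text \<open>The holomorphic extension has complex derivative \<open>d\<close> at the point, so it is
  injective on a small disc and has a holomorphic inverse \<open>H\<close> there. The real inverse
  \<open>B\<close> is the real part of \<open>H\<close> on the real axis.\<close>

lemma real_analytic_at_local_inverse:
  assumes g: "real_analytic_at g x" and deriv: "(g has_real_derivative d) (at x)" "d \<noteq> 0"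
  obtains B where "real_analytic_at B (g x)" "B (g x) = x"
    "\<forall>\<^sub>F y in nhds (g x). g (B y) = y"
proof -
  obtain G where G: "G analytic_on {of_real x}"
    "\<forall>\<^sub>F t in nhds x. G (of_real t) = complex_of_real (g t)"
    using g by (rule real_analytic_atE)
  obtain S where S: "open S" "of_real x \<in> S" "G holomorphic_on S"
    using G(1) unfolding analytic_at by blast
  \<comment> \<open>The derivative of \<open>G\<close> along the real axis is computed twice, once
    from holomorphy and once from \<open>g\<close>; uniqueness identifies the complex derivative
    with \<open>d\<close>.\<close>
  have "((\<lambda>t. G (of_real t)) has_vector_derivative deriv G (of_real x)) (at x)"
    using S by (intro has_vector_derivative_real_field holomorphic_derivI)
  moreover have "((\<lambda>t. G (of_real t)) has_vector_derivative of_real d) (at x)"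
    using has_vector_derivative_of_real[OF deriv(1)] G(2)
    by (subst has_vector_derivative_cong_ev[where g = "\<lambda>t. of_real (g t)"])
      (auto elim: eventually_mono dest: eventually_nhds_x_imp_x)
  ultimately have "deriv G (of_real x) = of_real d"
    by (rule vector_derivative_unique_at)
  then have "deriv G (of_real x) \<noteq> 0"
    using deriv(2) by simp
  then obtain r where r: "r > 0" "ball (of_real x) r \<subseteq> S" "inj_on G (ball (of_real x) r)"
    using has_complex_derivative_locally_injective[OF S(3,2,1)] by metis
  obtain e where e: "e > 0" "\<And>t. dist t x < e \<Longrightarrow> G (of_real t) = complex_of_real (g t)"
    using G(2) unfolding eventually_nhds_metric by blast
  \<comment> \<open>\<open>r\<close> gives injectivity of \<open>G\<close> on the disc,
    \<open>e\<close> gives agreement of \<open>G\<close> with \<open>g\<close> on its real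
    diameter.\<close>
  define \<delta> where "\<delta> = min r e"
  have \<delta>: "\<delta> > 0" "ball (complex_of_real x) \<delta> \<subseteq> ball (of_real x) r"
    using r e unfolding \<delta>_def by auto
  have of_real_ball: "complex_of_real t \<in> ball (of_real x) \<delta>" if "t \<in> ball x \<delta>" for t
    using that by (simp add: dist_of_real)
  have Gg: "G (of_real t) = complex_of_real (g t)" if "t \<in> ball x \<delta>" for t
    using that e(2) unfolding \<delta>_def by (simp add: dist_commute)
  have hol: "G holomorphic_on ball (of_real x) \<delta>" and inj: "inj_on G (ball (of_real x) \<delta>)"
    using S r \<delta> by (meson holomorphic_on_subset inj_on_subset subset_trans)+
  obtain H where H: "H holomorphic_on (G ` ball (of_real x) \<delta>)"
    "\<And>z. z \<in> ball (of_real x) \<delta> \<Longrightarrow> H (G z) = z"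
    using holomorphic_has_inverse[OF hol open_ball inj] by metis
  define B where "B y = Re (H (of_real y))" for y
  have HB: "H (of_real (g t)) = of_real t" "B (g t) = t" if "t \<in> ball x \<delta>" for t
    using H(2)[OF of_real_ball[OF that]] Gg[OF that] by (simp_all add: B_def)
  have "continuous_on (ball x \<delta>) (\<lambda>t. Re (G (of_real t)))"
    by (intro continuous_intros continuous_on_compose2[OF holomorphic_on_imp_continuous_on[OF hol]])
      (use of_real_ball in auto)
  then have "continuous_on (ball x \<delta>) g"
    by (rule continuous_on_eq) (simp only: Gg Re_complex_of_real)
  moreover have "inj_on g (ball x \<delta>)"
    using HB(2) by (metis inj_onI)
  \<comment> \<open>A continuous injective map of an interval is open. Hence every real
    \<open>y\<close> near \<open>g x\<close> has the form \<open>g t\<close>, and the identities for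
    \<open>H\<close> and \<open>B\<close> on such values hold on a full neighbourhood.\<close>
  ultimately have "open (g ` ball x \<delta>)"
    by (intro injective_into_1d_imp_open_map_UNIV[of _ "ball x \<delta>"]) auto
  then have image: "\<forall>\<^sub>F y in nhds (g x). y \<in> g ` ball x \<delta>"
    using \<delta>(1) by (intro eventually_nhds_in_open) auto
  show thesis
  proof (rule that)
    show "B (g x) = x"
      using \<delta>(1) by (simp add: HB)
    show "\<forall>\<^sub>F y in nhds (g x). g (B y) = y"
      using image by eventually_elim (auto simp: HB)
    have "\<forall>\<^sub>F y in nhds (g x). H (of_real y) = complex_of_real (B y)"
      using image by eventually_elim (auto simp: HB)
    moreover have "H analytic_on {of_real (g x)}"
      unfolding analytic_at
    proof (intro exI conjI)
      show "open (G ` ball (of_real x) \<delta>)"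
        using open_mapping_thm3[OF hol open_ball inj] .
      show "of_real (g x) \<in> G ` ball (of_real x) \<delta>"
        by (metis Gg \<delta>(1) centre_in_ball imageI)
    qed (rule H(1))
    ultimately show "real_analytic_at B (g x)"
      unfolding real_analytic_at_def by blast
  qed
qed

subsection \<open>The fixed point equation\<close>

lemma has_real_derivative_arcsin_sin:
  assumes "\<bar>k\<bar> < 1"
  shows "((\<lambda>\<psi>. arcsin (k * sin \<psi>)) has_real_derivative
    k * cos \<psi> / sqrt (1 - (k * sin \<psi>)\<^sup>2)) (at \<psi>)"
proof -
  have "\<bar>k * sin \<psi>\<bar> \<le> \<bar>k\<bar> * 1"
    unfolding abs_mult by (intro mult_left_mono) auto
  then have "- 1 < k * sin \<psi>" "k * sin \<psi> < 1"
    using assms by linarith+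
  then show ?thesis
    by (auto intro!: derivative_eq_intros simp: field_simps)
qed

text \<open>The derivative is \<open>c / (c + x^2)^(3/2)\<close>, which is positive.\<close>

lemma strict_mono_divide_sqrt_add_square:
  fixes c u v :: real
  assumes "c > 0" "u < v"
  shows "u / sqrt (c + u\<^sup>2) < v / sqrt (c + v\<^sup>2)"
proof (rule DERIV_pos_imp_increasing[OF assms(2)])
  fix x :: real
  have pos: "c + x\<^sup>2 > 0"
    using assms(1) by (simp add: add_pos_nonneg)
  then have sq: "sqrt (c + x\<^sup>2) * sqrt (c + x\<^sup>2) = c + x\<^sup>2"
    by simp
  have "((\<lambda>x. x / sqrt (c + x\<^sup>2)) has_real_derivative
      c / (sqrt (c + x\<^sup>2) * (c + x\<^sup>2))) (at x)"
    using pos sq by (auto intro!: derivative_eq_intros simp: field_simps power2_eq_square)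
  moreover have "c / (sqrt (c + x\<^sup>2) * (c + x\<^sup>2)) > 0"
    using pos assms(1) by simp
  ultimately show "\<exists>y. ((\<lambda>x. x / sqrt (c + x\<^sup>2)) has_real_derivative y) (at x) \<and> 0 < y"
    by blast
qed

text \<open>Strict concavity of a single arcsine term, without second derivatives: with
  \<open>u = k * cos t\<close> the quotient is \<open>u / sqrt ((1 - k^2) + u^2)\<close>, strictly
  increasing in \<open>u\<close>, while the cosine strictly decreases on
  \<open>[0, pi]\<close>.\<close>

lemma arcsin_sin_deriv_strict_antimono:
  fixes k p q :: real
  assumes "0 < k" "k < 1" "0 \<le> p" "p < q" "q \<le> pi"
  shows "k * cos q / sqrt (1 - (k * sin q)\<^sup>2) < k * cos p / sqrt (1 - (k * sin p)\<^sup>2)"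
proof -
  have "k\<^sup>2 < 1"
    using assms by (simp add: power_less_one_iff abs_square_less_1)
  moreover have "k * cos q < k * cos p"
    using assms by (simp add: cos_monotone_0_pi)
  moreover have eq: "1 - (k * sin t)\<^sup>2 = (1 - k\<^sup>2) + (k * cos t)\<^sup>2" for t
    by (simp add: cos_squared_eq power_mult_distrib algebra_simps)
  ultimately show ?thesis
    using strict_mono_divide_sqrt_add_square[of "1 - k\<^sup>2" "k * cos q" "k * cos p"]
    unfolding eq by simp
qed

section \<open>The fixed point problem with abstract coefficients\<close>

text \<open>The coefficients \<open>k i\<close> stand for the ratios of \<alpha>_0 to the moduli of
  the other couplings. The assumption \<open>sum_k\<close> says that the sum of arcsines has slope
  greater than 1 at 0.\<close>

locale phase_equation =
  fixes I :: "'i set" and k :: "'i \<Rightarrow> real"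
  assumes finite_I: "finite I"
    and k_pos: "i \<in> I \<Longrightarrow> 0 < k i"
    and k_less_1: "i \<in> I \<Longrightarrow> k i < 1"
    and sum_k: "1 < (\<Sum>i\<in>I. k i)"
begin

definition defect :: "real \<Rightarrow> real" where
  "defect \<psi> = (\<Sum>i\<in>I. arcsin (k i * sin \<psi>)) - \<psi>"

definition defect_deriv :: "real \<Rightarrow> real" where
  "defect_deriv \<psi> = (\<Sum>i\<in>I. k i * cos \<psi> / sqrt (1 - (k i * sin \<psi>)\<^sup>2)) - 1"

lemma has_real_derivative_defect: "(defect has_real_derivative defect_deriv \<psi>) (at \<psi>)"
proof -
  have "\<bar>k i\<bar> < 1" if "i \<in> I" for i
    using k_pos[OF that] k_less_1[OF that] by simp
  then show ?thesis
    unfolding defect_def[abs_def] defect_deriv_def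
    by (intro derivative_intros DERIV_sum has_real_derivative_arcsin_sin)
qed

lemma continuous_on_defect: "continuous_on S defect"
  using has_real_derivative_defect DERIV_continuous_on has_field_derivative_at_within by blast

lemma I_nonempty: "I \<noteq> {}"
  using sum_k by auto

lemma defect_deriv_strict_antimono:
  assumes "0 \<le> p" "p < q" "q \<le> pi"
  shows "defect_deriv q < defect_deriv p"
  unfolding defect_deriv_def
  using assms finite_I I_nonempty k_pos k_less_1
  by (simp add: sum_strict_mono arcsin_sin_deriv_strict_antimono)

lemma defect_critical_between:
  assumes "p < q" "defect p = defect q"
  obtains c where "p < c" "c < q" "defect_deriv c = 0"
proof -
  obtain c where c: "p < c" "c < q" "defect q - defect p = (q - p) * defect_deriv c"
    using MVT2[OF assms(1), of defect defect_deriv] has_real_derivative_defect by blast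
  with assms have "defect_deriv c = 0"
    by simp
  with c(1,2) show thesis
    by (rule that)
qed

lemma defect_0: "defect 0 = 0"
  by (simp add: defect_def)

lemma defect_pi: "defect pi = - pi"
  by (simp add: defect_def)

lemma root_less_pi:
  assumes "\<psi> \<le> pi" "defect \<psi> = 0"
  shows "\<psi> < pi"
  using assms defect_pi pi_gt_zero by (cases "\<psi> = pi") auto

text \<open>Since 0 is also a root, Rolle's theorem gives a critical point strictly between 0 and
  \<psi>; beyond it the strictly decreasing derivative is negative.\<close>

lemma defect_deriv_at_root_neg:
  assumes "0 < \<psi>" "\<psi> \<le> pi" "defect \<psi> = 0"
  shows "defect_deriv \<psi> < 0"
proof -
  obtain c where "0 < c" "c < \<psi>" "defect_deriv c = 0"
    using defect_critical_between[of 0 \<psi>] assms defect_0 by auto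
  then show ?thesis
    using defect_deriv_strict_antimono[of c \<psi>] assms by simp
qed

text \<open>The positive slope at 0 makes \<open>defect\<close> positive just to the right of 0, and
  it ends at \<open>- pi\<close>; the intermediate value theorem supplies a root.\<close>

lemma root_exists: "\<exists>\<psi>. 0 < \<psi> \<and> \<psi> \<le> pi \<and> defect \<psi> = 0"
proof -
  have "defect_deriv 0 > 0"
    using sum_k by (simp add: defect_deriv_def)
  then obtain d where d: "d > 0" "\<And>h. 0 < h \<Longrightarrow> h < d \<Longrightarrow> defect 0 < defect (0 + h)"
    using DERIV_pos_inc_right[OF has_real_derivative_defect] by blast
  \<comment> \<open>Halving keeps \<open>e\<close> strictly below \<open>d\<close>; the cap keeps it
    a valid left end point of an interval ending at \<open>pi\<close>.\<close>
  define e where "e = min (d / 2) pi"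
  have e: "0 < e" "e < d" "e \<le> pi"
    using d(1) unfolding e_def by auto
  have "defect e > 0"
    using d(2)[of e] e defect_0 by simp
  then have "\<exists>x\<ge>e. x \<le> pi \<and> defect x = 0"
    using e by (intro IVT2' continuous_on_defect) (auto simp: defect_pi)
  with e show ?thesis
    by (meson less_le_trans)
qed

text \<open>Two positive roots would enclose a critical point, but the derivative is already
  negative at the smaller root and decreases from there.\<close>

lemma root_unique:
  assumes "0 < p" "p \<le> pi" "defect p = 0" "0 < q" "q \<le> pi" "defect q = 0"
  shows "p = q"
proof -
  have False if "0 < p" "p < q" "q \<le> pi" "defect p = 0" "defect q = 0" for p q
  proof -
    from that have "p < q" "defect p = defect q"
      by simp_all
    then obtain c where "p < c" "c < q" "defect_deriv c = 0"
      by (rule defect_critical_between)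
    then show False
      using defect_deriv_strict_antimono[of p c] defect_deriv_at_root_neg[of p] that by simp
  qed
  with assms show ?thesis
    by (metis linorder_neqE_linordered_idom)
qed

end

section \<open>Parameters that determine the solution\<close>

text \<open>A common hypothesis for both families. The lower bound by the critical coupling is
  written with reciprocals, so that a varied coupling enters through one summand only. All
  conditions are strict and finite in number, hence stable under small changes of a
  parameter.\<close>

definition admissible :: "nat \<Rightarrow> (nat \<Rightarrow> real) \<Rightarrow> real \<Rightarrow> bool" where
  "admissible N \<alpha> a \<longleftrightarrow>
    0 < a \<and> (\<forall>\<mu>\<in>{1..N-1}. a < \<bar>\<alpha> \<mu>\<bar>) \<and> 1 / a < (\<Sum>\<mu>\<in>{1..N-1}. 1 / \<bar>\<alpha> \<mu>\<bar>)"

lemma admissible_phase_equation: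
  assumes "admissible N \<alpha> a"
  shows "phase_equation {1..N-1} (\<lambda>\<mu>. a / \<bar>\<alpha> \<mu>\<bar>)"
proof
  have a: "0 < a" and less: "\<And>\<mu>. \<mu> \<in> {1..N-1} \<Longrightarrow> a < \<bar>\<alpha> \<mu>\<bar>"
    and sum: "1 / a < (\<Sum>\<mu>\<in>{1..N-1}. 1 / \<bar>\<alpha> \<mu>\<bar>)"
    using assms by (auto simp: admissible_def)
  show "0 < a / \<bar>\<alpha> \<mu>\<bar>" "a / \<bar>\<alpha> \<mu>\<bar> < 1" if "\<mu> \<in> {1..N-1}" for \<mu>
    using a less[OF that] by simp_all
  have "a * (1 / a) < a * (\<Sum>\<mu>\<in>{1..N-1}. 1 / \<bar>\<alpha> \<mu>\<bar>)"
    using a sum by (intro mult_strict_left_mono)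
  then show "1 < (\<Sum>\<mu>\<in>{1..N-1}. a / \<bar>\<alpha> \<mu>\<bar>)"
    using a by (simp add: sum_distrib_left)
qed simp

lemma nonzero_solution_iff_defect:
  assumes "admissible N \<alpha> a"
  shows "nonzero_solution N \<alpha> a \<psi> \<longleftrightarrow>
    0 < \<psi> \<and> \<psi> \<le> pi \<and> phase_equation.defect {1..N-1} (\<lambda>\<mu>. a / \<bar>\<alpha> \<mu>\<bar>) \<psi> = 0"
proof -
  interpret phase_equation "{1..N-1}" "\<lambda>\<mu>. a / \<bar>\<alpha> \<mu>\<bar>"
    using assms by (rule admissible_phase_equation)
  have "defect \<psi> = 0 \<longleftrightarrow> \<psi> = phase_sum N \<alpha> a \<psi>"
    unfolding defect_def phase_sum_def by linarith
  then show ?thesis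
    by (auto simp: nonzero_solution_def)
qed

lemma ex1_nonzero_solution:
  assumes "admissible N \<alpha> a"
  shows "\<exists>!\<psi>. nonzero_solution N \<alpha> a \<psi>"
proof -
  interpret phase_equation "{1..N-1}" "\<lambda>\<mu>. a / \<bar>\<alpha> \<mu>\<bar>"
    using assms by (rule admissible_phase_equation)
  show ?thesis
    unfolding nonzero_solution_iff_defect[OF assms] using root_exists root_unique by blast
qed

lemma the_nonzero_solution_eqI:
  assumes "admissible N \<alpha> a" "nonzero_solution N \<alpha> a \<psi>"
  shows "the_nonzero_solution N \<alpha> a = \<psi>"
  unfolding the_nonzero_solution_def
  using ex1_nonzero_solution[OF assms(1)] assms(2) by (rule the1_equality)

text \<open>The last bound is \<open>f' \<psi> < 1\<close> written out; it is the nondegeneracy that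
  both local inversions rest on.\<close>

lemma nonzero_solution_bounds:
  assumes "admissible N \<alpha> a" "nonzero_solution N \<alpha> a \<psi>"
  shows "0 < \<psi>" "\<psi> < pi"
    "(\<Sum>\<mu>\<in>{1..N-1}. a / \<bar>\<alpha> \<mu>\<bar> * cos \<psi> / sqrt (1 - (a / \<bar>\<alpha> \<mu>\<bar> * sin \<psi>)\<^sup>2)) < 1"
proof -
  interpret phase_equation "{1..N-1}" "\<lambda>\<mu>. a / \<bar>\<alpha> \<mu>\<bar>"
    using assms(1) by (rule admissible_phase_equation)
  have *: "0 < \<psi> \<and> \<psi> \<le> pi \<and> defect \<psi> = 0"
    using assms by (simp add: nonzero_solution_iff_defect)
  then show "0 < \<psi>" "\<psi> < pi"
    using root_less_pi by auto
  show "(\<Sum>\<mu>\<in>{1..N-1}. a / \<bar>\<alpha> \<mu>\<bar> * cos \<psi> / sqrt (1 - (a / \<bar>\<alpha> \<mu>\<bar> * sin \<psi>)\<^sup>2)) < 1"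
    using defect_deriv_at_root_neg[of \<psi>] * unfolding defect_deriv_def by linarith
qed

subsection \<open>Analytic dependence on the couplings\<close>

text \<open>If \<open>B\<close> is the local inverse of \<open>g\<close> at \<open>s0\<close>, then
  \<open>h (B y)\<close> is analytic in \<open>y\<close> and solves the equation for the coupling
  \<open>y\<close>; uniqueness identifies it with the chosen solution.\<close>

lemma the_nonzero_solution_analytic_in_a:
  assumes adm: "admissible N \<alpha> a"
  shows "real_analytic_at (the_nonzero_solution N \<alpha>) a"
proof -
  define I where "I = {1..N-1}"
  obtain \<psi> where \<psi>: "nonzero_solution N \<alpha> a \<psi>"
    using ex1_nonzero_solution[OF adm] by blast
  note bounds = nonzero_solution_bounds[OF adm \<psi>]
  have a: "0 < a" and less: "\<And>\<mu>. \<mu> \<in> I \<Longrightarrow> a < \<bar>\<alpha> \<mu>\<bar>"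
    using adm by (auto simp: admissible_def I_def)
  have sin_pos: "sin \<psi> > 0"
    using bounds by (intro sin_gt_zero)
  have \<alpha>_nz: "\<alpha> \<mu> \<noteq> 0" if "\<mu> \<in> I" for \<mu>
    using less[OF that] a by auto
  define s0 where "s0 = a * sin \<psi>"
  define h where "h s = (\<Sum>\<mu>\<in>I. arcsin (s / \<bar>\<alpha> \<mu>\<bar>))" for s
  define h' where "h' = (\<Sum>\<mu>\<in>I. 1 / \<bar>\<alpha> \<mu>\<bar> / sqrt (1 - (s0 / \<bar>\<alpha> \<mu>\<bar>)\<^sup>2))"
  define g where "g s = s / sin (h s)" for s
  have s0_less: "\<bar>s0 / \<bar>\<alpha> \<mu>\<bar>\<bar> < 1" if "\<mu> \<in> I" for \<mu>
  proof -
    have "s0 \<le> a * 1"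
      unfolding s0_def using a by (intro mult_left_mono) auto
    moreover have "0 < s0"
      using a sin_pos by (simp add: s0_def)
    ultimately show ?thesis
      using less[OF that] by simp
  qed
  have h_eq: "h (b * sin p) = phase_sum N \<alpha> b p" for b p
    by (simp add: h_def phase_sum_def I_def)
  have h_s0: "h s0 = \<psi>"
    using \<psi> unfolding s0_def h_eq nonzero_solution_def by simp
  have g_s0: "g s0 = a"
    using sin_pos by (simp add: g_def h_s0) (simp add: s0_def)
  have h_analytic: "real_analytic_at h s0"
    unfolding h_def[abs_def]
    by (intro real_analytic_at_sum real_analytic_at_arcsin
        real_analytic_at_divide real_analytic_at_ident real_analytic_at_const)
      (use s0_less \<alpha>_nz in auto)
  then have g_analytic: "real_analytic_at g s0"
    unfolding g_def[abs_def] using sin_pos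
    by (intro real_analytic_at_divide real_analytic_at_ident real_analytic_at_sin)
      (auto simp: h_s0)
  have h_deriv: "(h has_real_derivative h') (at s0)"
    unfolding h_def[abs_def] h'_def
  proof (rule DERIV_sum)
    fix \<mu> assume "\<mu> \<in> I"
    from s0_less[OF this] have "- 1 < s0 / \<bar>\<alpha> \<mu>\<bar>" "s0 / \<bar>\<alpha> \<mu>\<bar> < 1"
      by linarith+
    then show "((\<lambda>s. arcsin (s / \<bar>\<alpha> \<mu>\<bar>)) has_real_derivative
        1 / \<bar>\<alpha> \<mu>\<bar> / sqrt (1 - (s0 / \<bar>\<alpha> \<mu>\<bar>)\<^sup>2)) (at s0)"
      using DERIV_chain2[OF DERIV_arcsin DERIV_cdivide[OF DERIV_ident, of "\<bar>\<alpha> \<mu>\<bar>"]]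
      by (simp add: field_simps)
  qed
  \<comment> \<open>By the chain rule the left side is \<open>f' \<psi>\<close>. Multiplication by
    \<open>sin \<psi>\<close> turns the bound into positivity of the numerator of the derivative of
    \<open>g\<close>.\<close>
  have "a * cos \<psi> * h' < 1"
    using bounds(3) by (simp add: h'_def s0_def sum_distrib_left I_def field_simps)
  then have "sin \<psi> * (a * cos \<psi> * h') < sin \<psi> * 1"
    using sin_pos by (rule mult_strict_left_mono)
  then have numerator: "sin \<psi> - s0 * cos \<psi> * h' > 0"
    by (simp add: s0_def mult_ac)
  have "(g has_real_derivative (sin \<psi> - s0 * cos \<psi> * h') / (sin \<psi>)\<^sup>2) (at s0)"
    unfolding g_def[abs_def] using sin_pos
    by (auto intro!: derivative_eq_intros h_deriv simp: h_s0 power2_eq_square)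
  moreover have "(sin \<psi> - s0 * cos \<psi> * h') / (sin \<psi>)\<^sup>2 \<noteq> 0"
    using numerator sin_pos by simp
  ultimately obtain B where B: "real_analytic_at B a" "B a = s0"
    "\<forall>\<^sub>F y in nhds a. g (B y) = y"
    using real_analytic_at_local_inverse[OF g_analytic] g_s0 by metis
  have hB: "real_analytic_at (\<lambda>y. h (B y)) a"
    using B h_analytic by (auto intro: real_analytic_at_compose[OF B(1)])
  have lim: "filterlim (\<lambda>y. h (B y)) (nhds \<psi>) (nhds a)"
    using real_analytic_at_imp_tendsto[OF hB] by (simp add: B(2) h_s0)
  have range: "\<forall>\<^sub>F y in nhds a. 0 < h (B y)" "\<forall>\<^sub>F y in nhds a. h (B y) < pi"
    using order_tendstoD(1)[OF lim bounds(1)] order_tendstoD(2)[OF lim bounds(2)] .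
  have adm_near: "\<forall>\<^sub>F y in nhds a. admissible N \<alpha> y"
    unfolding admissible_def
  proof (intro eventually_conj eventually_ball_finite ballI)
    have id: "((\<lambda>y. y) \<longlongrightarrow> a) (nhds a)"
      by (rule filterlim_ident)
    show "\<forall>\<^sub>F y in nhds a. 0 < y"
      using order_tendstoD(1)[OF id a] .
    show "\<forall>\<^sub>F y in nhds a. y < \<bar>\<alpha> \<mu>\<bar>" if "\<mu> \<in> {1..N-1}" for \<mu>
      using order_tendstoD(2)[OF id] less that by (simp add: I_def)
    have "((\<lambda>y. 1 / y) \<longlongrightarrow> 1 / a) (nhds a)"
      using a by (intro tendsto_divide tendsto_const id) auto
    from order_tendstoD(2)[OF this] adm
    show "\<forall>\<^sub>F y in nhds a. 1 / y < (\<Sum>\<mu>\<in>{1..N-1}. 1 / \<bar>\<alpha> \<mu>\<bar>)"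
      by (simp add: admissible_def)
  qed simp
  have "\<forall>\<^sub>F y in nhds a. the_nonzero_solution N \<alpha> y = h (B y)"
    using B(3) range adm_near
  proof eventually_elim
    case (elim y)
    have "sin (h (B y)) > 0"
      using elim by (intro sin_gt_zero)
    \<comment> \<open>Clearing the denominator in \<open>g (B y) = y\<close> shows that
      \<open>B y\<close> is the auxiliary variable \<open>s\<close> belonging to the coupling
      \<open>y\<close> and the phase \<open>h (B y)\<close>.\<close>
    with elim(1) have B_y: "y * sin (h (B y)) = B y"
      by (simp add: g_def field_simps)
    have "h (B y) = phase_sum N \<alpha> y (h (B y))"
      unfolding h_eq[symmetric] B_y ..
    then have "nonzero_solution N \<alpha> y (h (B y))"
      using elim by (simp add: nonzero_solution_def)
    with elim(4) show ?case
      by (rule the_nonzero_solution_eqI)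
  qed
  with hB show ?thesis
    by (rule real_analytic_at_cong)
qed

text \<open>Here \<open>g p\<close> is the modulus of the varied coupling for which \<open>p\<close>
  solves the equation, so the solution itself is the local inverse of \<open>g\<close>. The update
  by \<open>- x\<close> keeps the coupling negative with modulus \<open>x\<close>.\<close>

lemma the_nonzero_solution_analytic_in_coupling:
  assumes \<nu>: "\<nu> \<in> {1..N-1}" and x: "x > 0" and adm: "admissible N (\<alpha>(\<nu> := - x)) a"
  shows "real_analytic_at (\<lambda>x. the_nonzero_solution N (\<alpha>(\<nu> := - x)) a) x"
proof -
  define J where "J = {1..N-1} - {\<nu>}"
  have I_eq: "{1..N-1} = insert \<nu> J" "\<nu> \<notin> J" "finite J"
    using \<nu> by (auto simp: J_def)
  have sum_split: "(\<Sum>\<mu>\<in>{1..N-1}. F \<mu> ((\<alpha>(\<nu> := - y)) \<mu>)) = F \<nu> (- y) + (\<Sum>\<mu>\<in>J. F \<mu> (\<alpha> \<mu>))"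
    for F :: "nat \<Rightarrow> real \<Rightarrow> real" and y
  proof -
    have "(\<Sum>\<mu>\<in>J. F \<mu> ((\<alpha>(\<nu> := - y)) \<mu>)) = (\<Sum>\<mu>\<in>J. F \<mu> (\<alpha> \<mu>))"
      using I_eq(2) by (intro sum.cong) auto
    then show ?thesis
      unfolding I_eq(1) using I_eq(2,3) by simp
  qed
  obtain \<psi> where \<psi>: "nonzero_solution N (\<alpha>(\<nu> := - x)) a \<psi>"
    using ex1_nonzero_solution[OF adm] by blast
  note bounds = nonzero_solution_bounds[OF adm \<psi>]
  have a: "0 < a" and less: "\<And>\<mu>. \<mu> \<in> J \<Longrightarrow> a < \<bar>\<alpha> \<mu>\<bar>" and ax: "a < x"
    using adm x I_eq by (auto simp: admissible_def split: if_splits)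
  have sin_pos: "sin \<psi> > 0"
    using bounds by (intro sin_gt_zero)
  define r where "r p = (\<Sum>\<mu>\<in>J. arcsin (a / \<bar>\<alpha> \<mu>\<bar> * sin p))" for p
  define r' where "r' = (\<Sum>\<mu>\<in>J. a / \<bar>\<alpha> \<mu>\<bar> * cos \<psi> / sqrt (1 - (a / \<bar>\<alpha> \<mu>\<bar> * sin \<psi>)\<^sup>2))"
  define g where "g p = a * sin p / sin (p - r p)" for p
  have phase_sum_eq: "phase_sum N (\<alpha>(\<nu> := - y)) a p = arcsin (a / y * sin p) + r p" if "y > 0" for y p
    unfolding phase_sum_def r_def
    using sum_split[of "\<lambda>\<mu> c. arcsin (a / \<bar>c\<bar> * sin p)" y] that by simp
  \<comment> \<open>At the solution, \<theta> is the arcsine term of the varied coupling, hence lies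
    strictly inside the principal branch.\<close>
  define \<theta> where "\<theta> = \<psi> - r \<psi>"
  have \<theta>: "\<theta> = arcsin (a / x * sin \<psi>)"
    using \<psi> phase_sum_eq[OF x, of \<psi>] by (simp add: \<theta>_def nonzero_solution_def)
  have q: "0 < a / x * sin \<psi>" "a / x * sin \<psi> < 1"
  proof -
    show "0 < a / x * sin \<psi>"
      using a x sin_pos by simp
    have "a / x * sin \<psi> \<le> a / x * 1"
      using a x by (intro mult_left_mono) auto
    also have "\<dots> < 1"
      using ax x by simp
    finally show "a / x * sin \<psi> < 1" .
  qed
  have sin_\<theta>: "sin \<theta> = a / x * sin \<psi>"
    unfolding \<theta> using q by (intro sin_arcsin) linarith+
  then have sin_\<theta>_nz: "sin \<theta> \<noteq> 0"
    using q by linarith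
  have cos_\<theta>: "cos \<theta> = sqrt (1 - (a / x * sin \<psi>)\<^sup>2)"
    unfolding \<theta> using q by (intro cos_arcsin) linarith+
  have cos_\<theta>_pos: "cos \<theta> > 0"
    using q unfolding cos_\<theta> by (simp add: abs_square_less_1)
  have \<theta>_bounds: "- (pi / 2) < \<theta>" "\<theta> < pi / 2"
    using arcsin_lt_bounded[of "a / x * sin \<psi>"] q unfolding \<theta> by linarith+
  have J_less: "\<bar>a / \<bar>\<alpha> \<mu>\<bar>\<bar> < 1" if "\<mu> \<in> J" for \<mu>
    using less[OF that] a by simp
  have J_less': "\<bar>a / \<bar>\<alpha> \<mu>\<bar> * sin \<psi>\<bar> < 1" if "\<mu> \<in> J" for \<mu>
  proof -
    have "\<bar>a / \<bar>\<alpha> \<mu>\<bar> * sin \<psi>\<bar> \<le> \<bar>a / \<bar>\<alpha> \<mu>\<bar>\<bar> * 1"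
      unfolding abs_mult by (intro mult_left_mono) auto
    with J_less[OF that] show ?thesis
      by linarith
  qed
  have r_analytic: "real_analytic_at r \<psi>"
    unfolding r_def[abs_def] using J_less'
    by (intro real_analytic_at_sum real_analytic_at_arcsin real_analytic_at_mult
        real_analytic_at_const real_analytic_at_sin real_analytic_at_ident)
  have g_analytic: "real_analytic_at g \<psi>"
    unfolding g_def[abs_def]
    by (intro real_analytic_at_divide real_analytic_at_mult real_analytic_at_diff
        real_analytic_at_const real_analytic_at_ident real_analytic_at_sin
        r_analytic) (use sin_\<theta>_nz in \<open>simp add: \<theta>_def\<close>)
  have g_\<psi>: "g \<psi> = x"
    using sin_\<theta> a x sin_pos by (simp add: g_def flip: \<theta>_def)
  have r_deriv: "(r has_real_derivative r') (at \<psi>)"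
    unfolding r_def[abs_def] r'_def
    using J_less by (intro DERIV_sum has_real_derivative_arcsin_sin)
  have "a / x * cos \<psi> / cos \<theta> + r' < 1"
    using bounds(3) sum_split[of "\<lambda>\<mu> c. a / \<bar>c\<bar> * cos \<psi> / sqrt (1 - (a / \<bar>c\<bar> * sin \<psi>)\<^sup>2)" x] x
    by (simp add: cos_\<theta> r'_def)
  \<comment> \<open>The preceding bound is \<open>f' \<psi> < 1\<close> with the varied term split
    off. Since \<open>sin \<theta> = a / x * sin \<psi>\<close>, scaling it by
    \<open>sin \<psi> * cos \<theta>\<close> gives the sign of the numerator of the derivative of
    \<open>g\<close>.\<close>
  then have "sin \<psi> * cos \<theta> * (a / x * cos \<psi> / cos \<theta>) < sin \<psi> * cos \<theta> * (1 - r')"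
    using sin_pos cos_\<theta>_pos by (intro mult_strict_left_mono) auto
  then have numerator: "cos \<psi> * sin \<theta> - sin \<psi> * (cos \<theta> * (1 - r')) < 0"
    using cos_\<theta>_pos by (simp add: sin_\<theta> mult_ac)
  have "(g has_real_derivative
      (a * cos \<psi> * sin \<theta> - a * sin \<psi> * (cos \<theta> * (1 - r'))) / (sin \<theta> * sin \<theta>)) (at \<psi>)"
    unfolding g_def[abs_def] \<theta>_def
    by (rule DERIV_divide[OF DERIV_cmult[OF DERIV_sin]
        DERIV_chain2[OF DERIV_sin DERIV_diff[OF DERIV_ident r_deriv]]])
      (use sin_\<theta>_nz in \<open>simp add: \<theta>_def\<close>)
  then have "(g has_real_derivative
      a * (cos \<psi> * sin \<theta> - sin \<psi> * (cos \<theta> * (1 - r'))) / (sin \<theta>)\<^sup>2) (at \<psi>)"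
    by (simp only: power2_eq_square right_diff_distrib mult.assoc)
  moreover have "a * (cos \<psi> * sin \<theta> - sin \<psi> * (cos \<theta> * (1 - r'))) / (sin \<theta>)\<^sup>2 \<noteq> 0"
    using numerator a sin_\<theta>_nz by simp
  ultimately obtain B where B: "real_analytic_at B x" "B x = \<psi>"
    "\<forall>\<^sub>F y in nhds x. g (B y) = y"
    using real_analytic_at_local_inverse[OF g_analytic] g_\<psi> by metis
  have lim: "filterlim B (nhds \<psi>) (nhds x)"
    using real_analytic_at_imp_tendsto[OF B(1)] by (simp add: B(2))
  have range: "\<forall>\<^sub>F y in nhds x. 0 < B y" "\<forall>\<^sub>F y in nhds x. B y < pi"
    using order_tendstoD(1)[OF lim bounds(1)] order_tendstoD(2)[OF lim bounds(2)] .
  have rB: "real_analytic_at (\<lambda>y. B y - r (B y)) x"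
    using B r_analytic by (auto intro: real_analytic_at_diff real_analytic_at_compose[OF B(1)])
  have lim': "filterlim (\<lambda>y. B y - r (B y)) (nhds \<theta>) (nhds x)"
    using real_analytic_at_imp_tendsto[OF rB] by (simp add: B(2) \<theta>_def)
  \<comment> \<open>Inverting \<open>g\<close> only yields an identity between sines; staying within
    the principal branch allows the arcsine to be restored.\<close>
  have range': "\<forall>\<^sub>F y in nhds x. - (pi / 2) < B y - r (B y)"
      "\<forall>\<^sub>F y in nhds x. B y - r (B y) < pi / 2"
    using order_tendstoD(1)[OF lim' \<theta>_bounds(1)] order_tendstoD(2)[OF lim' \<theta>_bounds(2)] .
  have admissible_iff: "admissible N (\<alpha>(\<nu> := - y)) a \<longleftrightarrow> a < y \<and> 1 / a < 1 / y + (\<Sum>\<mu>\<in>J. 1 / \<bar>\<alpha> \<mu>\<bar>)"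
    if "y > 0" for y
    using sum_split[of "\<lambda>\<mu> c. 1 / \<bar>c\<bar>" y] that a less \<nu> unfolding admissible_def
    by (auto simp: J_def)
  have pos: "\<forall>\<^sub>F y in nhds x. 0 < y"
    using order_tendstoD(1)[OF filterlim_ident x] .
  have "\<forall>\<^sub>F y in nhds x. a < y \<and> 1 / a < 1 / y + (\<Sum>\<mu>\<in>J. 1 / \<bar>\<alpha> \<mu>\<bar>)"
  proof (rule eventually_conj)
    have id: "((\<lambda>y. y) \<longlongrightarrow> x) (nhds x)"
      by (rule filterlim_ident)
    show "\<forall>\<^sub>F y in nhds x. a < y"
      using order_tendstoD(1)[OF id ax] .
    have "((\<lambda>y. 1 / y + (\<Sum>\<mu>\<in>J. 1 / \<bar>\<alpha> \<mu>\<bar>)) \<longlongrightarrow> 1 / x + (\<Sum>\<mu>\<in>J. 1 / \<bar>\<alpha> \<mu>\<bar>)) (nhds x)"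
      using x by (intro tendsto_add tendsto_divide tendsto_const id) auto
    from order_tendstoD(1)[OF this] adm
    show "\<forall>\<^sub>F y in nhds x. 1 / a < 1 / y + (\<Sum>\<mu>\<in>J. 1 / \<bar>\<alpha> \<mu>\<bar>)"
      by (simp add: admissible_iff[OF x])
  qed
  with pos have adm_near: "\<forall>\<^sub>F y in nhds x. admissible N (\<alpha>(\<nu> := - y)) a"
    by eventually_elim (simp add: admissible_iff)
  have "\<forall>\<^sub>F y in nhds x. the_nonzero_solution N (\<alpha>(\<nu> := - y)) a = B y"
    using B(3) range range' pos adm_near
  proof eventually_elim
    case (elim y)
    \<comment> \<open>Division by zero yields 0, so a vanishing denominator would give
      \<open>g (B y) = 0\<close>, contrary to \<open>g (B y) = y > 0\<close>.\<close>
    have "sin (B y - r (B y)) \<noteq> 0"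
      using elim(1,6) by (auto simp: g_def)
    then have "sin (B y - r (B y)) = a / y * sin (B y)"
      using elim(1,6) by (simp add: g_def field_simps)
    then have "B y - r (B y) = arcsin (a / y * sin (B y))"
      using arcsin_sin[of "B y - r (B y)"] elim by simp
    then have "B y = phase_sum N (\<alpha>(\<nu> := - y)) a (B y)"
      using phase_sum_eq[OF elim(6)] by simp
    then have "nonzero_solution N (\<alpha>(\<nu> := - y)) a (B y)"
      using elim by (simp add: nonzero_solution_def)
    with elim(7) show ?case
      by (rule the_nonzero_solution_eqI)
  qed
  with B(1) show ?thesis
    by (rule real_analytic_at_cong)
qed

section \<open>The stated parameter ranges are admissible\<close>

theorem proposition4:
  fixes N \<tau> :: nat and \<alpha> :: "nat \<Rightarrow> real"
  assumes "N > 2"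
    and "\<And>\<mu>. 0 < \<mu> \<Longrightarrow> \<mu> < N \<Longrightarrow> \<alpha> \<mu> < 0"
    and "\<tau> \<in> {1..N-1}"
    and "\<bar>\<alpha> \<tau>\<bar> = Min ((\<lambda>\<mu>. \<bar>\<alpha> \<mu>\<bar>) ` {1..N-1})"
  shows
    "(\<forall>a. critical_coupling N \<alpha> < a \<and> a < \<bar>\<alpha> \<tau>\<bar> \<longrightarrow> (\<exists>!\<Psi>. nonzero_solution N \<alpha> a \<Psi>)) \<and>
     real_analytic_on (\<lambda>a. the_nonzero_solution N \<alpha> a) {critical_coupling N \<alpha> <..< \<bar>\<alpha> \<tau>\<bar>} \<and>
     (\<forall>a. 0 < a \<and> a < \<bar>\<alpha> \<tau>\<bar> \<longrightarrow>
        (\<forall>x \<in> coupling_range N \<tau> \<alpha> a. \<exists>!\<Psi>. nonzero_solution N (\<alpha>(N - \<tau> := - x)) a \<Psi>) \<and>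
        real_analytic_on (\<lambda>x. the_nonzero_solution N (\<alpha>(N - \<tau> := - x)) a)
          (coupling_range N \<tau> \<alpha> a))"
proof -
  have neg: "\<alpha> \<mu> < 0" if "\<mu> \<in> {1..N-1}" for \<mu>
    using assms(2)[of \<mu>] that assms(1) by auto
  have min: "\<bar>\<alpha> \<tau>\<bar> \<le> \<bar>\<alpha> \<mu>\<bar>" if "\<mu> \<in> {1..N-1}" for \<mu>
    unfolding assms(4) using that by (intro Min_le) auto
  have adm_a: "admissible N \<alpha> a" if "critical_coupling N \<alpha> < a" "a < \<bar>\<alpha> \<tau>\<bar>" for a
  proof -
    define S where "S = (\<Sum>\<mu>\<in>{1..N-1}. inverse \<bar>\<alpha> \<mu>\<bar>)"
    have "S > 0"
      unfolding S_def using assms(1) neg by (intro sum_pos) (auto dest: less_imp_neq)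
    have "inverse S < a"
      using that(1) by (simp add: critical_coupling_def S_def)
    moreover from this have "0 < a"
      using \<open>S > 0\<close> by (meson less_trans positive_imp_inverse_positive)
    ultimately have "1 / a < S"
      using \<open>S > 0\<close> by (simp add: field_simps)
    then show ?thesis
      using \<open>0 < a\<close> that(2) min unfolding admissible_def S_def
      by (force simp: inverse_eq_divide)
  qed
  define \<nu> where "\<nu> = N - \<tau>"
  have \<nu>: "\<nu> \<in> {1..N-1}"
    using assms(3) by (auto simp: \<nu>_def)
  have adm_x: "0 < x \<and> admissible N (\<alpha>(\<nu> := - x)) a"
    if a: "0 < a" "a < \<bar>\<alpha> \<tau>\<bar>" and x: "x \<in> coupling_range N \<tau> \<alpha> a" for a x
  proof -
    define S where "S = reciprocal_sum_except N \<nu> \<alpha>"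
    \<comment> \<open>Both forms of the lower bound give this: it is either \<open>a\<close> itself
      or the modulus of \<open>\<alpha> \<tau>\<close>, which exceeds \<open>a\<close>.\<close>
    have "a < x"
      using x a by (auto simp: coupling_range_def split: if_splits)
    then have "0 < x"
      using a by simp
    \<comment> \<open>A finite upper end of the range is this inequality solved for
      \<open>x\<close>; in the unbounded case \<open>S\<close> alone reaches \<open>1 / a\<close>
      and \<open>1 / x\<close> is positive.\<close>
    have "1 / a < 1 / x + S"
    proof (cases "1 / a > S")
      case True
      then have "x < inverse (1 / a - S)"
        using x by (simp add: coupling_range_def S_def \<nu>_def Let_def)
      then have "x * (1 / a - S) < inverse (1 / a - S) * (1 / a - S)"
        using True by (intro mult_strict_right_mono) auto
      also have "\<dots> = 1"
        using True by simp
      finally show ?thesis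
        using \<open>0 < x\<close> by (simp add: field_simps)
    next
      case False
      moreover have "1 / x > 0"
        using \<open>0 < x\<close> by simp
      ultimately show ?thesis
        by linarith
    qed
    also have "1 / x + S = (\<Sum>\<mu>\<in>{1..N-1}. 1 / \<bar>(\<alpha>(\<nu> := - x)) \<mu>\<bar>)"
      unfolding S_def reciprocal_sum_except_def using \<nu> \<open>0 < x\<close>
      by (subst (2) sum.remove[of _ \<nu>]) auto
    finally show ?thesis
      using \<open>a < x\<close> a min \<open>0 < x\<close> unfolding admissible_def by (auto intro: less_le_trans)
  qed
  show ?thesis
    unfolding real_analytic_on_def \<nu>_def[symmetric]
    using adm_a adm_x ex1_nonzero_solution
      the_nonzero_solution_analytic_in_a[THEN real_analytic_at_imp_has_fps_expansion]
      the_nonzero_solution_analytic_in_coupling[OF \<nu>, THEN real_analytic_at_imp_has_fps_expansion]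
    by (intro conjI allI impI ballI) (auto simp del: fun_upd_apply)
qed

end
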